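(* Let $j\ge0$ and $b\ge1$ be fixed integers, let $c>0$ be fixed, and let $a=cm+b$. For $\pi=(\pi_1,\dots,\pi_m)$ chosen uniformly at random from $\mathrm{PF}(a,b,m)$, as $m\to\infty$, $$\mathbb P(\pi_1=1)=\cdots=\mathbb P(\pi_1=a)\sim\frac{1}{(b+c)m},$$ and $$\mathbb P(\pi_1=a+j)\sim e^{\frac{cm}{be}-\frac{b}{b+c}}\left(\frac{b}{b+c}\right)^{m-1}\frac{1}{cm^2}\big(\mathbb P(Y\ge\lceil j/b\rceil)-1\big)+\frac{1}{(b+c)m},$$ where $Y$ is a Poisson random variable with parameter $(cm)/(be)$.
   Context: $\mathrm{PF}(a,b,m)$, for positive integers $a,b,m$, is the set of $(a,b)$-parking functions of length $m$: sequences $(\pi_1,\dots,\pi_m)$ of positive integers whose non-decreasing rearrangement $(\lambda_1,\dots,\lambda_m)$ satisfies $\lambda_i\le a+(i-1)b$ for all $1\le i\le m$. Since $a=cm+b$ must be a positive integer, $m\to\infty$ runs through values for which $cm$ is an integer. Here $e$ is the base of the natural logarithm, $\lceil x\rceil$ is the smallest integer $\ge x$, and $f(m)\sim g(m)$ means $f(m)/g(m)\to1$ as $m\to\infty$. *)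

theory Defs
  imports "HOL-Probability.Probability" "HOL-Library.Landau_Symbols"
begin

text \<open>Sequences of length \<open>m\<close> are lists of length \<open>m\<close>; the entry \<open>\<pi>\<^sub>i\<close> is \<open>\<pi> ! (i - 1)\<close>, and the
  non-decreasing rearrangement of \<open>\<pi>\<close> is \<^term>\<open>sort \<pi>\<close>.\<close>

definition PF :: "nat \<Rightarrow> nat \<Rightarrow> nat \<Rightarrow> nat list set" where
  "PF a b m = {\<pi>. length \<pi> = m \<and> (\<forall>x\<in>set \<pi>. 1 \<le> x) \<and>
                  (\<forall>i\<in>{1..m}. sort \<pi> ! (i - 1) \<le> a + (i - 1) * b)}"

text \<open>For \<open>a \<ge> 1\<close> the set \<open>PF a b m\<close> is finite and nonempty, so that \<^const>\<open>pmf_of_set\<close> is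
  the uniform distribution on it.\<close>

lemma finite_PF: "finite (PF a b m)"
proof (rule finite_subset)
  show "PF a b m \<subseteq> {\<pi>. set \<pi> \<subseteq> {..a + m * b} \<and> length \<pi> = m}"
  proof (intro subsetI CollectI conjI)
    fix \<pi> x assume \<pi>: "\<pi> \<in> PF a b m" and "x \<in> set \<pi>"
    then obtain i where i: "i < m" "x = sort \<pi> ! i"
      by (metis (mono_tags, lifting) PF_def in_set_conv_nth length_sort mem_Collect_eq set_sort)
    have "\<forall>k\<in>{1..m}. sort \<pi> ! (k - 1) \<le> a + (k - 1) * b"
      using \<pi> by (simp add: PF_def)
    from this[rule_format, of "Suc i"] i have "x \<le> a + i * b" by simp
    also have "\<dots> \<le> a + m * b" using i by simp
    finally show "x \<in> {..a + m * b}" by simp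
  qed (simp add: PF_def)
qed (simp add: finite_lists_length_eq)

lemma PF_nonempty:
  assumes "1 \<le> a" shows "PF a b m \<noteq> {}"
proof -
  have "sort (replicate m (1::nat)) = replicate m 1"
    by (intro sorted_sort_id) simp
  with assms have "replicate m 1 \<in> PF a b m"
    by (auto simp: PF_def simp del: replicate_Suc)
  then show ?thesis by blast
qed

definition prob_first :: "nat \<Rightarrow> nat \<Rightarrow> nat \<Rightarrow> nat \<Rightarrow> real" where
  "prob_first a b m k = measure_pmf.prob (pmf_of_set (PF a b m)) {\<pi>. \<pi> ! 0 = k}"

end

theory Submission
  imports Defs "HOL-Real_Asymp.Real_Asymp"
begin

text \<open>
  Everything rests on the exact count \<open>|PF(a,b,m)| = a (a + m b)\<^sup>m\<^sup>-\<^sup>1\<close> (\<open>card_PF\<close>). It is obtained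
  by classifying parking functions by their number \<open>s\<close> of ones: removing the ones and lowering
  the other entries by one leaves an arbitrary element of \<open>PF(a - 1 + s b, b, m - s)\<close>, whence
  \<open>|PF(a,b,m)| = \<Sum>\<^sub>s (m choose s) |PF(a - 1 + s b, b, m - s)|\<close>. In all sets on
  the right, the first parameter plus the length times \<open>b\<close> is the same number \<open>N = a - 1 + m b\<close>,
  so the induction hypothesis turns the sum into a binomial one.

  If \<open>\<pi>\<^sub>1 \<le> a\<close>, the first entry meets every count condition, and the other entries form an
  arbitrary element of \<open>PF(a + b, b, m - 1)\<close>. Hence the probability
  \<open>(a + b) / (a (a + m b))\<close> is the same for all values up to \<open>a\<close>, and with \<open>a = c m + b\<close> it is
  asymptotic to \<open>1 / ((b + c) m)\<close>.

  For \<open>\<pi>\<^sub>1 = a + j\<close> it suffices to see that both the deviation from \<open>P(\<pi>\<^sub>1 = 1)\<close> and the Poisson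
  term are exponentially small. The deviation (\<open>prob_first_beyond\<close>) comes from the tails that
  park with a first entry \<open>1\<close> but not with \<open>a + j\<close>; such a tail has at most \<open>j\<close> entries
  \<open>\<le> a\<close>, whereas \<open>a\<close> is at least the proportion \<open>c / (b + c)\<close> of the range
  \<open>{1..a + m b}\<close>. Few tails are like this, by Markov's inequality for the weight
  \<open>2\<close> to the power minus the number of entries \<open>\<le> a\<close>. The Poisson term
  (\<open>poisson_term_smallo\<close>) is, after cancelling the exponential, a polynomial in \<open>m\<close> times
  \<open>(b / (b + c))\<^sup>m\<^sup>-\<^sup>1 / m\<^sup>2\<close>.
\<close>

section \<open>Parking functions described by counts\<close>

lemma sorted_nth_le_iff_count:
  fixes xs :: "'a::linorder list"
  assumes "sorted xs" "i < length xs"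
  shows "xs ! i \<le> t \<longleftrightarrow> i < length (filter (\<lambda>x. x \<le> t) xs)"
  using assms
proof (induction xs arbitrary: i)
  case (Cons x xs)
  show ?case
  proof (cases "x \<le> t")
    case True
    then show ?thesis using Cons by (cases i) auto
  next
    case False
    with Cons.prems have *: "\<forall>y\<in>set (x # xs). \<not> y \<le> t" by auto
    then have "filter (\<lambda>x. x \<le> t) (x # xs) = []" by (simp add: filter_empty_conv del: filter.simps)
    moreover have "\<not> (x # xs) ! i \<le> t" using * Cons.prems(2) nth_mem by blast
    ultimately show ?thesis by simp
  qed
qed simp

text \<open>Counting entries below a threshold removes the sorting from the definition, and the count
  behaves well under prepending, permuting and shuffling entries.\<close>

lemma mem_PF_iff:
  "xs \<in> PF a b m \<longleftrightarrow> length xs = m \<and> (\<forall>x\<in>set xs. 1 \<le> x) \<and>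
     (\<forall>i<m. i < length (filter (\<lambda>x. x \<le> a + i * b) xs))"
proof -
  have len: "length (filter (\<lambda>x. x \<le> t) (sort xs)) = length (filter (\<lambda>x. x \<le> t) xs)" for t
    by (simp flip: size_mset)
  have "(\<forall>i\<in>{1..m}. sort xs ! (i - 1) \<le> a + (i - 1) * b) \<longleftrightarrow>
        (\<forall>i<m. sort xs ! i \<le> a + i * b)"
  proof safe
    fix i assume "\<forall>i\<in>{1..m}. sort xs ! (i - 1) \<le> a + (i - 1) * b" "i < m"
    then show "sort xs ! i \<le> a + i * b" by (auto dest: bspec[of _ _ "Suc i"])
  qed auto
  then show ?thesis
    unfolding PF_def using sorted_nth_le_iff_count[of "sort xs"] len by auto
qed

lemma PF_set_subset:
  assumes "xs \<in> PF a b m"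
  shows "set xs \<subseteq> {1..a + (m - 1) * b}"
proof (cases "m = 0")
  case False
  let ?P = "\<lambda>x. x \<le> a + (m - 1) * b"
  have "m - 1 < length (filter ?P xs)" "length xs = m" and pos: "\<forall>x\<in>set xs. 1 \<le> x"
    using assms False by (auto simp: mem_PF_iff)
  then have "length (filter ?P xs) = length xs"
    using length_filter_le[of ?P xs] by linarith
  then have "\<forall>x\<in>set xs. ?P x" by (metis length_filter_less less_irrefl)
  with pos show ?thesis by auto
qed (use assms in \<open>auto simp: mem_PF_iff\<close>)

section \<open>The number of parking functions\<close>

lemma mem_shuffles_replicate_iff:
  assumes "v \<notin> set ys"
  shows "xs \<in> shuffles (replicate s v) ys \<longleftrightarrow>
         length (filter (\<lambda>y. y = v) xs) = s \<and> filter (\<lambda>y. y \<noteq> v) xs = ys"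
proof -
  have "partition (\<lambda>y. y = v) -` {(replicate s v, ys)} = shuffles (replicate s v) ys"
    using assms by (intro inv_image_partition) (auto simp: set_replicate_conv_if split: if_splits)
  moreover have "filter (\<lambda>y. y = v) xs = replicate (length (filter (\<lambda>y. y = v) xs)) v"
    by (induction xs) auto
  ultimately show ?thesis
    by (auto simp: o_def vimage_def set_eq_iff) (metis length_replicate)
qed

text \<open>Deleting the \<open>s\<close> ones of a parking function and lowering every other entry by one loses no
  information except the positions of the ones. The count condition at \<open>i < s\<close> is met by the
  ones alone, and at \<open>s + i\<close> it reads \<open>#{y \<le> x + s b + i b} > i\<close> for the shorter list, so that
  what remains is exactly a parking function with a larger first parameter. The positions are
  accounted for by the shuffles with a block of ones.\<close>

lemma PF_ones_decomposition:
  "{xs \<in> PF (Suc x) b m. length (filter (\<lambda>y. y = 1) xs) = s} =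
   (if s \<le> m then \<Union>ys\<in>map Suc ` PF (x + s * b) b (m - s). shuffles (replicate s 1) ys else {})"
   (is "?L = ?R")
proof -
  have key: "xs \<in> PF (Suc x) b m \<longleftrightarrow> q \<in> PF (x + s * b) b (m - s)"
    if s: "s \<le> m" and xs: "xs \<in> shuffles (replicate s 1) (map Suc q)" and q: "\<forall>y\<in>set q. 1 \<le> y" for xs q
  proof -
    have ms: "mset xs = mset (replicate s 1) + mset (map Suc q)"
      using mset_shuffles[OF xs] .
    have len: "length xs = s + length q"
      using arg_cong[OF ms, of size] by simp
    have "set_mset (mset xs) = set_mset (mset (replicate s 1) + mset (map Suc q))"
      by (simp only: ms)
    then have pos: "\<forall>y\<in>set xs. 1 \<le> y" by auto
    have cnt: "length (filter (\<lambda>y. y \<le> Suc x + i * b) xs) = s + length (filter (\<lambda>y. y \<le> x + i * b) q)" for i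
    proof -
      have "length (filter (\<lambda>y. y \<le> Suc x + i * b) xs) =
            size (filter_mset (\<lambda>y. y \<le> Suc x + i * b) (mset (replicate s 1) + mset (map Suc q)))"
        by (simp only: ms[symmetric] mset_filter[symmetric] size_mset)
      also have "\<dots> = length (filter (\<lambda>y. y \<le> Suc x + i * b) (replicate s 1)) +
            length (filter (\<lambda>y. y \<le> Suc x + i * b) (map Suc q))"
        by (simp only: filter_union_mset size_union size_mset mset_filter[symmetric])
      finally show ?thesis by (simp add: filter_map o_def)
    qed
    have "(\<forall>i<m. i < s + length (filter (\<lambda>y. y \<le> x + i * b) q)) \<longleftrightarrow>
          (\<forall>i<m - s. i < length (filter (\<lambda>y. y \<le> x + s * b + i * b) q))"
    proof safe
      fix i assume "\<forall>i<m. i < s + length (filter (\<lambda>y. y \<le> x + i * b) q)" "i < m - s"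
      then have "s + i < s + length (filter (\<lambda>y. y \<le> x + (s + i) * b) q)"
        by (metis less_diff_conv2 s add.commute less_diff_conv)
      then show "i < length (filter (\<lambda>y. y \<le> x + s * b + i * b) q)" by (simp add: algebra_simps)
    next
      fix i assume *: "\<forall>i<m - s. i < length (filter (\<lambda>y. y \<le> x + s * b + i * b) q)" "i < m"
      show "i < s + length (filter (\<lambda>y. y \<le> x + i * b) q)"
      proof (cases "i < s")
        case False
        then obtain k where k: "i = s + k" by (metis le_Suc_ex not_less)
        with * have "k < length (filter (\<lambda>y. y \<le> x + s * b + k * b) q)" by simp
        with k show ?thesis by (simp add: algebra_simps)
      qed simp
    qed
    with len pos q s cnt show ?thesis by (auto simp: mem_PF_iff)
  qed
  show ?thesis
  proof (intro equalityI subsetI)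
    fix xs assume "xs \<in> ?L"
    then have xs: "xs \<in> PF (Suc x) b m" and s: "length (filter (\<lambda>y. y = 1) xs) = s" by auto
    have "s \<le> m" using xs s length_filter_le[of "\<lambda>y. y = 1" xs] by (auto simp: mem_PF_iff)
    define q where "q = map (\<lambda>y. y - 1) (filter (\<lambda>y. y \<noteq> 1) xs)"
    have pos: "\<forall>y\<in>set xs. 1 \<le> y" using xs by (simp add: mem_PF_iff)
    have q: "map Suc q = filter (\<lambda>y. y \<noteq> 1) xs"
      unfolding q_def map_map using pos by (intro map_idI) (auto simp: Suc_le_eq)
    have q1: "\<forall>y\<in>set q. 1 \<le> y" using pos by (force simp: q_def)
    have "1 \<notin> set (map Suc q)" using q1 by auto
    then have sh: "xs \<in> shuffles (replicate s 1) (map Suc q)"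
      using mem_shuffles_replicate_iff[of 1 "map Suc q" xs s] s q by simp
    with key[OF \<open>s \<le> m\<close> sh q1] xs \<open>s \<le> m\<close> show "xs \<in> ?R" by auto
  next
    fix xs assume "xs \<in> ?R"
    then obtain q where s: "s \<le> m" and q: "q \<in> PF (x + s * b) b (m - s)"
      and sh: "xs \<in> shuffles (replicate s 1) (map Suc q)" by (auto split: if_splits)
    have q1: "\<forall>y\<in>set q. 1 \<le> y" using q by (simp add: mem_PF_iff)
    then have "1 \<notin> set (map Suc q)" by auto
    with mem_shuffles_replicate_iff[of 1 "map Suc q" xs s] sh key[OF s sh q1] q show "xs \<in> ?L" by auto
  qed
qed

lemma card_PF_ones:
  assumes "s \<le> m"
  shows "card {xs \<in> PF (Suc x) b m. length (filter (\<lambda>y. y = 1) xs) = s} =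
         (m choose s) * card (PF (x + s * b) b (m - s))"
proof -
  let ?Q = "map Suc ` PF (x + s * b) b (m - s)"
  have Q: "1 \<notin> set ys" "length ys = m - s" if "ys \<in> ?Q" for ys
    using that by (auto simp: mem_PF_iff)
  have "card {xs \<in> PF (Suc x) b m. length (filter (\<lambda>y. y = 1) xs) = s} =
        card (\<Union>ys\<in>?Q. shuffles (replicate s 1) ys)"
    using assms by (simp only: PF_ones_decomposition if_True)
  also have "\<dots> = (\<Sum>ys\<in>?Q. card (shuffles (replicate s 1) ys))"
  proof (intro card_UN_disjoint ballI impI)
    show "finite ?Q" by (simp add: finite_PF)
    fix ys zs assume *: "ys \<in> ?Q" "zs \<in> ?Q" "ys \<noteq> zs"
    show "shuffles (replicate s 1) ys \<inter> shuffles (replicate s 1) zs = {}"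
    proof (rule equals0I)
      fix xs assume "xs \<in> shuffles (replicate s 1) ys \<inter> shuffles (replicate s 1) zs"
      then have xs: "xs \<in> shuffles (replicate s 1) ys" "xs \<in> shuffles (replicate s 1) zs"
        by blast+
      have "filter (\<lambda>y. y \<noteq> 1) xs = ys"
        using xs(1) by (rule mem_shuffles_replicate_iff[OF Q(1)[OF *(1)], THEN iffD1, THEN conjunct2])
      moreover have "filter (\<lambda>y. y \<noteq> 1) xs = zs"
        using xs(2) by (rule mem_shuffles_replicate_iff[OF Q(1)[OF *(2)], THEN iffD1, THEN conjunct2])
      ultimately show False using *(3) by (metis (no_types))
    qed
  qed (simp add: finite_shuffles)
  also have "\<dots> = (\<Sum>ys\<in>?Q. m choose s)"
    using Q assms by (intro sum.cong refl, subst card_disjoint_shuffles) (auto simp: set_replicate_conv_if split: if_splits)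
  also have "\<dots> = (m choose s) * card (PF (x + s * b) b (m - s))"
    by (simp add: card_image inj_on_subset[OF inj_mapI])
  finally show ?thesis .
qed

lemma card_PF_rec:
  "card (PF (Suc x) b m) = (\<Sum>s\<le>m. (m choose s) * card (PF (x + s * b) b (m - s)))"
proof -
  have "card (PF (Suc x) b m) = card (\<Union>s\<in>{..m}. {xs \<in> PF (Suc x) b m. length (filter (\<lambda>y. y = 1) xs) = s})"
    by (intro arg_cong[of _ _ card]) (auto simp: mem_PF_iff)
  also have "\<dots> = (\<Sum>s\<le>m. card {xs \<in> PF (Suc x) b m. length (filter (\<lambda>y. y = 1) xs) = s})"
    by (rule card_UN_disjoint) (auto intro: finite_subset[OF _ finite_PF])
  also have "\<dots> = (\<Sum>s\<le>m. (m choose s) * card (PF (x + s * b) b (m - s)))"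
    by (intro sum.cong refl card_PF_ones) auto
  finally show ?thesis .
qed

text \<open>Up to a factor \<open>N\<close>, this is the right-hand side of the recursion once the counts are known:
  the binomial theorem and its derivative.\<close>

lemma weighted_binomial_sum:
  fixes N :: nat
  shows "(\<Sum>s\<le>Suc k. (Suc k choose s) * ((x + s * b) * N ^ (Suc k - s))) =
         (N + 1) ^ k * (x * (N + 1) + Suc k * b)"
proof -
  have 0: "(\<Sum>s\<le>k. (k choose s) * N ^ (k - s)) = (N + 1) ^ k"
    using binomial[of 1 N k] by (simp add: add.commute)
  have 1: "(\<Sum>s\<le>Suc k. (Suc k choose s) * N ^ (Suc k - s)) = (N + 1) ^ Suc k"
    using binomial[of 1 N "Suc k"] by (simp add: add.commute)
  have "(\<Sum>s\<le>Suc k. s * (Suc k choose s) * N ^ (Suc k - s)) =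
        (\<Sum>s\<le>k. Suc s * (Suc k choose Suc s) * N ^ (k - s))"
    by (subst sum.atMost_Suc_shift) (simp del: binomial_Suc_Suc)
  also have "\<dots> = (\<Sum>s\<le>k. Suc k * ((k choose s) * N ^ (k - s)))"
    by (intro sum.cong refl) (simp only: Suc_times_binomial mult.assoc)
  also have "\<dots> = Suc k * (N + 1) ^ k"
    by (simp only: sum_distrib_left[symmetric] 0)
  finally have 2: "(\<Sum>s\<le>Suc k. s * (Suc k choose s) * N ^ (Suc k - s)) = Suc k * (N + 1) ^ k" .
  have "(\<Sum>s\<le>Suc k. (Suc k choose s) * ((x + s * b) * N ^ (Suc k - s))) =
        x * (\<Sum>s\<le>Suc k. (Suc k choose s) * N ^ (Suc k - s)) +
        b * (\<Sum>s\<le>Suc k. s * (Suc k choose s) * N ^ (Suc k - s))"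
    unfolding sum_distrib_left sum.distrib[symmetric]
    by (intro sum.cong refl) (simp only: algebra_simps)
  also have "\<dots> = (N + 1) ^ k * (x * (N + 1) + Suc k * b)"
    unfolding 1 2 by (simp add: algebra_simps)
  finally show ?thesis .
qed

text \<open>Multiplying by \<open>a + m b\<close> avoids the exponent \<open>m - 1\<close> and covers \<open>m = 0\<close> and \<open>a = 0\<close>, which
  the recursion reaches. The summand \<open>s = 0\<close> keeps \<open>m\<close> and lowers \<open>a\<close>, the others lower \<open>m\<close>:
  hence an induction on \<open>a\<close> inside one on \<open>m\<close>.\<close>

lemma card_PF:
  assumes "1 \<le> b"
  shows "(a + m * b) * card (PF a b m) = a * (a + m * b) ^ m"
proof (induction m arbitrary: a rule: less_induct)
  case (less m)
  show ?case
  proof (cases m)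
    case 0
    have "PF a b 0 = {[]}" by (auto simp: mem_PF_iff)
    with 0 show ?thesis by simp
  next
    case (Suc k)
    show ?thesis
    proof (induction a)
      case 0
      have "xs \<notin> PF 0 b m" for xs
      proof
        assume xs: "xs \<in> PF 0 b m"
        then have "0 < length (filter (\<lambda>y. y \<le> 0 + 0 * b) xs)" and "\<forall>y\<in>set xs. 1 \<le> y"
          using Suc by (auto simp: mem_PF_iff)
        then show False by (auto simp: filter_empty_conv)
      qed
      then have "PF 0 b m = {}" by blast
      then show ?case by simp
    next
      case (Suc x)
      define N where "N = x + m * b"
      have "0 < N" using \<open>m = Suc k\<close> assms by (simp add: N_def)
      have summand: "N * card (PF (x + s * b) b (m - s)) = (x + s * b) * N ^ (m - s)" if "s \<le> m" for s
      proof (cases "s = 0")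
        case True
        then show ?thesis using Suc.IH by (simp add: N_def)
      next
        case False
        with that \<open>m = Suc k\<close> have "m - s < m" by simp
        moreover have "s * b + (m - s) * b = m * b"
          using that by (simp flip: add_mult_distrib)
        then have "x + s * b + (m - s) * b = N" by (simp add: N_def)
        ultimately show ?thesis using less.IH[of "m - s" "x + s * b"] by simp
      qed
      have "N * card (PF (Suc x) b m) =
            (\<Sum>s\<le>m. (m choose s) * (N * card (PF (x + s * b) b (m - s))))"
        unfolding card_PF_rec sum_distrib_left by (simp add: mult_ac)
      also have "\<dots> = (\<Sum>s\<le>m. (m choose s) * ((x + s * b) * N ^ (m - s)))"
        by (intro sum.cong refl) (simp add: summand)
      also have "\<dots> = (N + 1) ^ k * (x * (N + 1) + m * b)"
        unfolding \<open>m = Suc k\<close> by (rule weighted_binomial_sum)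
      also have "x * (N + 1) + m * b = N * Suc x" by (simp add: N_def algebra_simps)
      finally have "N * card (PF (Suc x) b m) = N * (Suc x * (N + 1) ^ k)" by (simp only: mult_ac)
      then have "card (PF (Suc x) b m) = Suc x * (N + 1) ^ k" using \<open>0 < N\<close> by simp
      moreover have "Suc x + m * b = N + 1" by (simp add: N_def)
      ultimately show ?case using \<open>m = Suc k\<close> by (simp only: power_Suc mult_ac)
    qed
  qed
qed

lemma card_PF_Suc:
  assumes "1 \<le> b"
  shows "card (PF a b (Suc n)) = a * (a + Suc n * b) ^ n"
proof -
  have "(a + Suc n * b) * card (PF a b (Suc n)) = (a + Suc n * b) * (a * (a + Suc n * b) ^ n)"
    using card_PF[OF assms, of a "Suc n"] by (simp add: mult_ac)
  with assms show ?thesis by simp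
qed

section \<open>The distribution of the first entry\<close>

text \<open>A first entry \<open>k \<le> a\<close> is counted at every threshold. It settles the condition at \<open>i = 0\<close>
  and shifts the index of the remaining ones by one, which replaces \<open>a\<close> by \<open>a + b\<close>.\<close>

lemma Cons_mem_PF_iff:
  assumes "1 \<le> k" "k \<le> a"
  shows "k # xs \<in> PF a b (Suc n) \<longleftrightarrow> xs \<in> PF (a + b) b n"
proof -
  have "(\<forall>i<Suc n. i < Suc (length (filter (\<lambda>x. x \<le> a + i * b) xs))) \<longleftrightarrow>
        (\<forall>i<n. i < length (filter (\<lambda>x. x \<le> a + b + i * b) xs))"
    by (subst All_less_Suc2) (simp add: add.assoc)
  with assms show ?thesis by (auto simp: mem_PF_iff trans_le_add1)
qed

lemma prob_first_eq_card:
  assumes "1 \<le> a"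
  shows "prob_first a b (Suc n) k = card {xs. k # xs \<in> PF a b (Suc n)} / card (PF a b (Suc n))"
proof -
  have "PF a b (Suc n) \<inter> {\<pi>. \<pi> ! 0 = k} = Cons k ` {xs. k # xs \<in> PF a b (Suc n)}"
  proof (intro equalityI subsetI)
    fix xs assume *: "xs \<in> PF a b (Suc n) \<inter> {\<pi>. \<pi> ! 0 = k}"
    then obtain y ys where "xs = y # ys" by (cases xs) (auto simp: mem_PF_iff)
    with * show "xs \<in> Cons k ` {xs. k # xs \<in> PF a b (Suc n)}" by auto
  qed auto
  then have "card (PF a b (Suc n) \<inter> {\<pi>. \<pi> ! 0 = k}) = card {xs. k # xs \<in> PF a b (Suc n)}"
    by (simp add: card_image)
  then show ?thesis
    unfolding prob_first_def using PF_nonempty[OF assms] finite_PF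
    by (subst measure_pmf_of_set) auto
qed

lemma prob_first_small:
  assumes "1 \<le> b" "1 \<le> k" "k \<le> a"
  shows "prob_first a b (Suc n) k = (a + b) / (a * (a + Suc n * b))"
proof -
  have c1: "card {xs. k # xs \<in> PF a b (Suc n)} = card (PF (a + b) b n)"
    using assms by (simp add: Cons_mem_PF_iff)
  define M where "M = a + Suc n * b"
  have "M > 0" using assms by (simp add: M_def)
  have "M * card (PF (a + b) b n) = (a + b) * M ^ n"
    using card_PF[OF assms(1), of "a + b" n] by (simp add: M_def algebra_simps)
  then have "real M * card (PF (a + b) b n) = (real a + b) * M ^ n"
    by (simp flip: of_nat_mult of_nat_add of_nat_power)
  then have c2: "real (card (PF (a + b) b n)) = (real a + b) * M ^ n / M"
    using \<open>M > 0\<close> by (simp add: field_simps)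
  have "prob_first a b (Suc n) k = real (card (PF (a + b) b n)) / (real a * M ^ n)"
    using assms by (simp add: prob_first_eq_card c1 card_PF_Suc M_def)
  also have "\<dots> = (a + b) / (real a * M)"
    unfolding c2 using \<open>M > 0\<close> assms by (simp add: field_simps)
  finally show ?thesis by (simp add: M_def)
qed

lemma sum_prod_list_lists:
  fixes f :: "'a \<Rightarrow> 'b::comm_semiring_1"
  assumes "finite A"
  shows "(\<Sum>xs | set xs \<subseteq> A \<and> length xs = n. prod_list (map f xs)) = (\<Sum>x\<in>A. f x) ^ n"
proof (induction n)
  case 0
  have "{xs. set xs \<subseteq> A \<and> length xs = 0} = {[]}" by auto
  then show ?case by simp
next
  case (Suc n)
  let ?L = "\<lambda>n. {xs. set xs \<subseteq> A \<and> length xs = n}"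
  have "?L (Suc n) = (\<lambda>(xs, x). x # xs) ` (?L n \<times> A)"
    by (subst lists_length_Suc_eq) auto
  then have "(\<Sum>xs\<in>?L (Suc n). prod_list (map f xs)) =
      (\<Sum>(xs, x)\<in>?L n \<times> A. f x * prod_list (map f xs))"
    by (simp, subst sum.reindex) (auto simp: inj_on_def intro!: sum.cong)
  also have "\<dots> = (\<Sum>x\<in>A. f x) * (\<Sum>xs\<in>?L n. prod_list (map f xs))"
    by (simp add: sum.cartesian_product[symmetric] sum_product sum.swap[of _ _ A] mult.commute)
  finally show ?case using Suc by simp
qed

text \<open>Markov's inequality: with a factor \<open>1/2\<close> for each entry \<open>\<le> t\<close>, every list counted here has
  weight at least \<open>1 / 2\<^sup>j\<close>, while the total weight of all lists is a power.\<close>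

lemma card_lists_few_small:
  assumes "t \<le> M"
  shows "real (card {xs. set xs \<subseteq> {1..M} \<and> length xs = n \<and> length (filter (\<lambda>x. x \<le> t) xs) \<le> j})
         \<le> 2 ^ j * (real M - real t / 2) ^ n"
proof -
  define L where "L = {xs. set xs \<subseteq> {1..M} \<and> length xs = n}"
  define f where "f = (\<lambda>x::nat. if x \<le> t then 1 / 2 else 1 :: real)"
  have fin: "finite L" unfolding L_def by (simp add: finite_lists_length_eq)
  have wt: "prod_list (map f xs) = (1 / 2) ^ length (filter (\<lambda>x. x \<le> t) xs)" for xs
    by (induction xs) (auto simp: f_def)
  have "real (card {xs \<in> L. length (filter (\<lambda>x. x \<le> t) xs) \<le> j})
        = (\<Sum>xs | xs \<in> L \<and> length (filter (\<lambda>x. x \<le> t) xs) \<le> j. 1)" by simp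
  also have "\<dots> \<le> (\<Sum>xs | xs \<in> L \<and> length (filter (\<lambda>x. x \<le> t) xs) \<le> j. 2 ^ j * prod_list (map f xs))"
  proof (intro sum_mono)
    fix xs assume "xs \<in> {xs. xs \<in> L \<and> length (filter (\<lambda>x. x \<le> t) xs) \<le> j}"
    then have "(2::real) ^ length (filter (\<lambda>x. x \<le> t) xs) \<le> 2 ^ j" by (auto intro: power_increasing)
    then show "1 \<le> 2 ^ j * prod_list (map f xs)" by (simp add: wt field_simps power_one_over)
  qed
  also have "\<dots> \<le> (\<Sum>xs\<in>L. 2 ^ j * prod_list (map f xs))"
    using fin by (intro sum_mono2) (auto simp: wt)
  also have "\<dots> = 2 ^ j * (\<Sum>x\<in>{1..M}. f x) ^ n"
    unfolding L_def by (simp add: sum_distrib_left[symmetric] sum_prod_list_lists)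
  also have "(\<Sum>x\<in>{1..M}. f x) = (\<Sum>x\<in>{1..t}. f x) + (\<Sum>x\<in>{t<..M}. f x)"
    using assms by (subst sum.union_disjoint[symmetric]) (auto intro!: sum.cong)
  also have "\<dots> = real M - real t / 2"
    using assms by (simp add: f_def of_nat_diff)
  finally show ?thesis by (simp add: L_def conj_assoc)
qed

text \<open>A tail \<open>xs\<close> that parks with \<open>1\<close> but not with \<open>a + j\<close> must fail at some \<open>i\<close> whose threshold
  \<open>a + i b\<close> lies below \<open>a + j\<close>, so \<open>i < j\<close>; failing means that at most \<open>i\<close> entries of \<open>xs\<close> are
  within the threshold, hence at most \<open>j\<close> are \<open>\<le> a\<close>.\<close>

lemma prob_first_beyond:
  fixes a b n j :: nat
  assumes "1 \<le> b" "1 \<le> a"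
  defines "M \<equiv> a + Suc n * b"
  shows "\<bar>prob_first a b (Suc n) (a + j) - prob_first a b (Suc n) 1\<bar>
          \<le> 2 ^ j * (1 - real a / (2 * real M)) ^ n / real a"
proof -
  let ?T = "\<lambda>k. {xs. k # xs \<in> PF a b (Suc n)}"
  have "M > 0" "a \<le> M" using assms by auto
  have sub: "?T (a + j) \<subseteq> ?T 1"
  proof clarify
    fix xs assume *: "(a + j) # xs \<in> PF a b (Suc n)"
    have "length (filter (\<lambda>x. x \<le> t) ((a + j) # xs)) \<le> length (filter (\<lambda>x. x \<le> t) (1 # xs))"
      if "1 \<le> t" for t using that by simp
    then have "i < length (filter (\<lambda>x. x \<le> a + i * b) (1 # xs))" if "i < Suc n" for i
      using * that assms(2) unfolding mem_PF_iff by (meson less_le_trans trans_le_add1)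
    with * show "1 # xs \<in> PF a b (Suc n)" by (auto simp: mem_PF_iff)
  qed
  have fin: "finite (?T k)" for k
    using finite_vimageI[OF finite_PF, of "Cons k" a b "Suc n"] by (simp add: vimage_def)
  have bad: "?T 1 - ?T (a + j) \<subseteq>
     {xs. set xs \<subseteq> {1..M} \<and> length xs = n \<and> length (filter (\<lambda>x. x \<le> a) xs) \<le> j}"
  proof clarify
    fix xs assume 1: "1 # xs \<in> PF a b (Suc n)" and 2: "(a + j) # xs \<notin> PF a b (Suc n)"
    have len: "length xs = n" using 1 by (simp add: mem_PF_iff)
    have "set xs \<subseteq> {1..M}" using PF_set_subset[OF 1] by (auto simp: M_def)
    moreover obtain i where i: "i < Suc n"
      and ni: "\<not> i < length (filter (\<lambda>x. x \<le> a + i * b) ((a + j) # xs))"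
      using 1 2 assms(2) by (auto simp: mem_PF_iff)
    have "i < length (filter (\<lambda>x. x \<le> a + i * b) (1 # xs))"
      using 1 i unfolding mem_PF_iff by blast
    with ni assms(2) have "i * b < j" and le: "length (filter (\<lambda>x. x \<le> a + i * b) xs) \<le> i"
      by (auto split: if_splits)
    then have "i \<le> j" using assms(1) by (metis less_imp_le_nat le_trans mult_le_mono2 nat_mult_1_right)
    have "length (filter (\<lambda>x. x \<le> a) xs) \<le> length (filter (\<lambda>x. x \<le> a + i * b) xs)"
      by (induction xs) auto
    with le \<open>i \<le> j\<close> have "length (filter (\<lambda>x. x \<le> a) xs) \<le> j" by linarith
    ultimately show "set xs \<subseteq> {1..M} \<and> length xs = n \<and> length (filter (\<lambda>x. x \<le> a) xs) \<le> j"
      using len by blast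
  qed
  have finbad: "finite {xs. set xs \<subseteq> {1..M} \<and> length xs = n \<and> length (filter (\<lambda>x. x \<le> a) xs) \<le> j}"
    by (rule finite_subset[OF _ finite_lists_length_eq[of "{1..M}" n]]) auto
  have "real (card (?T 1)) - real (card (?T (a + j))) = real (card (?T 1 - ?T (a + j)))"
    using sub fin by (simp add: card_Diff_subset card_mono of_nat_diff)
  also have "\<dots> \<le> 2 ^ j * (real M - real a / 2) ^ n"
    using card_mono[OF finbad bad] card_lists_few_small[OF \<open>a \<le> M\<close>, of n j] by linarith
  finally have diff: "\<bar>real (card (?T (a + j))) - real (card (?T 1))\<bar> \<le> 2 ^ j * (real M - real a / 2) ^ n"
    using card_mono[OF fin sub] by simp
  have cardPF: "real (card (PF a b (Suc n))) = real a * real M ^ n"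
    by (simp add: card_PF_Suc[OF assms(1)] M_def)
  have "\<bar>prob_first a b (Suc n) (a + j) - prob_first a b (Suc n) 1\<bar> =
        \<bar>real (card (?T (a + j))) - real (card (?T 1))\<bar> / (real a * real M ^ n)"
    using assms(2) by (simp add: prob_first_eq_card cardPF abs_divide flip: diff_divide_distrib)
  also have "\<dots> \<le> 2 ^ j * (real M - real a / 2) ^ n / (real a * real M ^ n)"
    using diff by (intro divide_right_mono) auto
  also have "\<dots> = 2 ^ j * ((real M - real a / 2) / real M) ^ n / real a"
    by (simp add: power_divide)
  also have "(real M - real a / 2) / real M = 1 - real a / (2 * real M)"
    using \<open>M > 0\<close> by (simp add: field_simps)
  finally show ?thesis .
qed

section \<open>Exponentially small terms\<close>

lemma exp_times_poisson_tail_minus_1: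
  assumes "0 < l"
  shows "exp l * (measure_pmf.prob (poisson_pmf l) {y. z \<le> int y} - 1) =
         - (\<Sum>s<nat z. l ^ s / fact s)"
proof -
  have "{y. z \<le> int y} = UNIV - {..<nat z}" by auto
  then have "measure_pmf.prob (poisson_pmf l) {y. z \<le> int y} =
      1 - measure_pmf.prob (poisson_pmf l) {..<nat z}"
    using measure_pmf.prob_compl[of "{..<nat z}" "poisson_pmf l"] by simp
  also have "measure_pmf.prob (poisson_pmf l) {..<nat z} = (\<Sum>s<nat z. l ^ s / fact s) * exp (- l)"
    unfolding sum_distrib_right
    using assms by (subst measure_measure_pmf_finite, simp, intro sum.cong) simp_all
  finally show ?thesis by (simp add: exp_minus field_simps)
qed

lemma geometric_smallo_inverse:
  fixes q :: real
  assumes "0 < q" "q < 1"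
  shows "(\<lambda>m. q ^ (m - 1) * real m ^ s) \<in> o(\<lambda>m. 1 / real m)"
proof -
  have "ln q < 0" using assms by simp
  then have "(\<lambda>m. q ^ m * real m ^ s) \<in> o(\<lambda>m. 1 / real m)"
    using assms by real_asymp
  then have "(\<lambda>m. (1 / q) * (q ^ m * real m ^ s)) \<in> o(\<lambda>m. 1 / real m)"
    by (rule landau_o.small.cmult_in_iff[THEN iffD2, rotated]) (use assms in simp)
  moreover have "eventually (\<lambda>m. q ^ (m - 1) * real m ^ s = (1 / q) * (q ^ m * real m ^ s)) sequentially"
    using eventually_gt_at_top[of 0]
    by eventually_elim (use assms in \<open>auto simp: gr0_conv_Suc\<close>)
  ultimately show ?thesis by (subst landau_o.small.in_cong)
qed

text \<open>Carries a limit over all \<open>m\<close> to the values of \<open>m\<close> for which \<open>c m\<close> is an integer.\<close>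

lemma asymp_equiv_filter_mono:
  assumes "f \<sim>[F] g" "G \<le> F"
  shows "f \<sim>[G] g"
  using assms by (auto simp: asymp_equiv_def intro: tendsto_mono)

text \<open>The factor \<open>exp (K m)\<close> is cancelled by the Poisson weights, and the event \<open>Y < z\<close> has a
  fixed number of outcomes: what is left is a polynomial in \<open>m\<close>, which the geometric factor
  dominates.\<close>

lemma poisson_term_smallo:
  fixes q c d K :: real and z :: int
  assumes "0 < q" "q < 1" "0 < K" "0 < c"
  shows "(\<lambda>m. exp (K * real m - d) * q ^ (m - 1) * (1 / (c * real m ^ 2)) *
            (measure_pmf.prob (poisson_pmf (K * real m)) {y. z \<le> int y} - 1))
         \<in> o(\<lambda>m. 1 / real m)"
proof -
  have eq: "exp (K * real m - d) * q ^ (m - 1) * (1 / (c * real m ^ 2)) *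
            (measure_pmf.prob (poisson_pmf (K * real m)) {y. z \<le> int y} - 1) =
            - exp (- d) / c * ((\<Sum>s<nat z. K ^ s / fact s * (q ^ (m - 1) * real m ^ s)) / real m ^ 2)" for m
    \<comment> \<open>For \<open>m = 0\<close>, where the Poisson rate is not positive, both sides are zero through division by zero.\<close>
  proof (cases "m = 0")
    case False
    have "exp (K * real m - d) * q ^ (m - 1) * (1 / (c * real m ^ 2)) *
            (measure_pmf.prob (poisson_pmf (K * real m)) {y. z \<le> int y} - 1) =
          exp (- d) / c * q ^ (m - 1) / real m ^ 2 * (exp (K * real m) *
            (measure_pmf.prob (poisson_pmf (K * real m)) {y. z \<le> int y} - 1))"
      by (simp add: exp_diff exp_minus field_simps)
    also have "\<dots> = - exp (- d) / c * (q ^ (m - 1) * (\<Sum>s<nat z. (K * real m) ^ s / fact s) / real m ^ 2)"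
      using assms False by (subst exp_times_poisson_tail_minus_1) auto
    also have "q ^ (m - 1) * (\<Sum>s<nat z. (K * real m) ^ s / fact s) =
               (\<Sum>s<nat z. K ^ s / fact s * (q ^ (m - 1) * real m ^ s))"
      by (simp add: sum_distrib_left power_mult_distrib mult_ac)
    finally show ?thesis .
  qed simp
  let ?S = "\<lambda>m. \<Sum>s<nat z. K ^ s / fact s * (q ^ (m - 1) * real m ^ s)"
  have S: "?S \<in> o(\<lambda>m. 1 / real m)"
    using geometric_smallo_inverse[OF assms(1,2)] by (intro big_sum_in_smallo) simp
  have "(\<lambda>m. ?S m / real m ^ 2) \<in> O(?S)"
  proof (rule bigoI[of _ 1])
    show "eventually (\<lambda>m. norm (?S m / real m ^ 2) \<le> 1 * norm (?S m)) sequentially"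
      using eventually_gt_at_top[of 0]
    proof eventually_elim
      case (elim m)
      then have "1 \<le> real m ^ 2" by (simp add: one_le_power)
      then show ?case by (simp add: divide_le_eq mult_le_cancel_left1)
    qed
  qed
  from landau_o.big_small_trans[OF this S] show ?thesis
    unfolding eq using assms by (subst landau_o.small.cmult_in_iff) auto
qed

section \<open>Asymptotics of the first entry\<close>

theorem corollary3p11:
  fixes j b :: nat and c :: real and a :: "nat \<Rightarrow> nat" and F :: "nat filter"
  assumes b: "1 \<le> b" and c: "0 < c"
    and a: "\<And>m. c * real m \<in> \<int> \<Longrightarrow> real (a m) = c * real m + real b"
  defines "F \<equiv> inf sequentially (principal {m. c * real m \<in> \<int>})"
  shows
    "(\<forall>m\<ge>1. c * real m \<in> \<int> \<longrightarrow>
        (\<forall>k\<in>{1..a m}. prob_first (a m) b m k = prob_first (a m) b m 1)) \<and>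
     (\<lambda>m. prob_first (a m) b m 1) \<sim>[F] (\<lambda>m. 1 / ((real b + c) * real m)) \<and>
     (\<lambda>m. prob_first (a m) b m (a m + j)) \<sim>[F]
       (\<lambda>m. exp (c * real m / (real b * exp 1) - real b / (real b + c))
              * (real b / (real b + c)) ^ (m - 1) * (1 / (c * real m ^ 2))
              * (measure_pmf.prob (poisson_pmf (c * real m / (real b * exp 1)))
                   {y. \<lceil>real j / real b\<rceil> \<le> int y} - 1)
            + 1 / ((real b + c) * real m))"
proof (intro conjI)
  define B where "B = real b"
  have B: "1 \<le> B" using b by (simp add: B_def)
  have a_pos: "1 \<le> a m" if "c * real m \<in> \<int>" for m
  proof -
    have "0 \<le> c * real m" using c by simp
    then have "1 \<le> real (a m)" using a[OF that] b by linarith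
    then show ?thesis by simp
  qed
  have F: "F \<le> sequentially" by (simp add: F_def)
  have "eventually (\<lambda>m. c * real m \<in> \<int>) F"
    unfolding F_def by (auto simp: eventually_inf_principal)
  moreover have "eventually (\<lambda>m. 1 \<le> m) F"
    by (rule filter_leD[OF F eventually_ge_at_top])
  ultimately have ev: "eventually (\<lambda>m. 1 \<le> m \<and> c * real m \<in> \<int>) F"
    by eventually_elim simp
  show "\<forall>m\<ge>1. c * real m \<in> \<int> \<longrightarrow>
        (\<forall>k\<in>{1..a m}. prob_first (a m) b m k = prob_first (a m) b m 1)"
  proof (intro allI impI ballI)
    fix m k assume "1 \<le> m" "c * real m \<in> \<int>" "k \<in> {1..a m}"
    then obtain n where "m = Suc n" "1 \<le> k" "k \<le> a m" by (auto simp: gr0_conv_Suc Suc_le_eq)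
    with b show "prob_first (a m) b m k = prob_first (a m) b m 1"
      by (simp add: prob_first_small)
  qed
  let ?A = "\<lambda>m. (c * real m + 2 * B) / ((c * real m + B) * (c * real m + B + real m * B))"
  have "eventually (\<lambda>m. prob_first (a m) b m 1 = ?A m) F"
    using ev
  proof eventually_elim
    case (elim m)
    then obtain n where n: "m = Suc n" by (cases m) auto
    have "prob_first (a m) b m 1 = real (a m + b) / real (a m * (a m + m * b))"
      unfolding n using b a_pos[of m] elim n by (subst prob_first_small) auto
    with a[of m] elim show ?case by (simp add: B_def)
  qed
  moreover have "?A \<sim>[F] (\<lambda>m. 1 / ((B + c) * real m))"
  proof (rule asymp_equiv_filter_mono[OF _ F])
    show "?A \<sim>[sequentially] (\<lambda>m. 1 / ((B + c) * real m))"
    proof (rule asymp_equivI')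
      let ?R = "\<lambda>m. (c + 2 * B / real m) * (B + c) / ((c + B / real m) * (c + B + B / real m))"
      have "?R \<longlonglongrightarrow> (c + 0) * (B + c) / ((c + 0) * (c + B + 0))"
        using B c by (intro tendsto_intros lim_const_over_n) auto
      then have "?R \<longlonglongrightarrow> 1" using B c by (simp add: add.commute)
      moreover have "eventually (\<lambda>m. ?R m = ?A m / (1 / ((B + c) * real m))) sequentially"
        using eventually_gt_at_top[of 0]
      proof eventually_elim
        case (elim m)
        have "c + 2 * B / real m = (c * real m + 2 * B) / real m"
          "c + B / real m = (c * real m + B) / real m"
          "c + B + B / real m = (c * real m + B + real m * B) / real m"
          using elim by (simp_all add: field_simps)
        then show ?case using elim by simp
      qed
      ultimately show "(\<lambda>m. ?A m / (1 / ((B + c) * real m))) \<longlonglongrightarrow> 1"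
        by (rule Lim_transform_eventually)
    qed
  qed
  ultimately have P1: "(\<lambda>m. prob_first (a m) b m 1) \<sim>[F] (\<lambda>m. 1 / ((B + c) * real m))"
    by (subst asymp_equiv_cong) auto
  then show "(\<lambda>m. prob_first (a m) b m 1) \<sim>[F] (\<lambda>m. 1 / ((real b + c) * real m))"
    by (simp add: B_def)
  \<comment> \<open>\<open>a / M \<ge> c / (B + c)\<close> for \<open>M = a + m b\<close>, so \<open>r\<close> bounds the ratio in the estimate of the deviation.\<close>
  define r where "r = 1 - c / (2 * (B + c))"
  have r: "0 < r" "r < 1" using B c by (auto simp: r_def field_simps)
  have scale: "o[F](\<lambda>m. 1 / ((B + c) * real m)) = o[F](\<lambda>m. 1 / real m)"
    using landau_o.small.cmult[of "1 / (B + c)" F "\<lambda>m. 1 / real m"] B c by simp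
  let ?D = "\<lambda>m. prob_first (a m) b m (a m + j) - prob_first (a m) b m 1"
  have "?D \<in> O[F](\<lambda>m. r ^ (m - 1) * real m ^ 0)"
  proof (rule bigoI[of _ "2 ^ j"])
    show "eventually (\<lambda>m. norm (?D m) \<le> 2 ^ j * norm (r ^ (m - 1) * real m ^ 0)) F"
      using ev
    proof eventually_elim
      case (elim m)
      then obtain n where n: "m = Suc n" by (cases m) auto
      have am: "1 \<le> a m" "real (a m) = c * real m + B" using elim a_pos a by (auto simp: B_def)
      let ?M = "real (a m + m * b)"
      have "0 < ?M" using am(1) by (simp only: of_nat_0_less_iff)
      then have M: "0 < 2 * ?M" "real (a m) \<le> 2 * ?M" by simp_all
      have "c / (2 * (B + c)) \<le> real (a m) / (2 * ?M)"
      proof -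
        have "c * (2 * ?M) \<le> real (a m) * (2 * (B + c))"
          using B c by (simp add: am algebra_simps flip: B_def)
        then show ?thesis using M B c by (simp add: pos_divide_le_eq pos_le_divide_eq)
      qed
      moreover have "0 \<le> 1 - real (a m) / (2 * ?M)"
        using M by (simp only: diff_ge_0_iff_ge divide_le_eq_1_pos)
      ultimately have le: "(1 - real (a m) / (2 * ?M)) ^ n \<le> r ^ n"
        by (intro power_mono) (auto simp: r_def)
      have "\<bar>?D m\<bar> \<le> 2 ^ j * (1 - real (a m) / (2 * ?M)) ^ n / real (a m)"
        using prob_first_beyond[OF b am(1), of n j] by (simp add: n)
      also have "\<dots> \<le> 2 ^ j * r ^ n / real (a m)"
        using le by (intro divide_right_mono mult_left_mono) simp_all
      also have "\<dots> \<le> 2 ^ j * r ^ n"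
        using am(1) r divide_left_mono[of 1 "real (a m)" "2 ^ j * r ^ n"] by simp
      finally show ?case using r by (simp add: n)
    qed
  qed
  also have "(\<lambda>m. r ^ (m - 1) * real m ^ 0) \<in> o[F](\<lambda>m. 1 / real m)"
    using landau_o.small.filter_mono[OF F geometric_smallo_inverse[OF r]] .
  finally have D: "?D \<in> o[F](\<lambda>m. 1 / ((B + c) * real m))"
    unfolding scale .
  define E where "E = (\<lambda>m. exp (c * real m / (real b * exp 1) - real b / (real b + c))
              * (real b / (real b + c)) ^ (m - 1) * (1 / (c * real m ^ 2))
              * (measure_pmf.prob (poisson_pmf (c * real m / (real b * exp 1)))
                   {y. \<lceil>real j / real b\<rceil> \<le> int y} - 1))"
  have "E \<in> o(\<lambda>m. 1 / real m)"
    using poisson_term_smallo[of "B / (B + c)" "c / (B * exp 1)" c "B / (B + c)" "\<lceil>real j / B\<rceil>"] B c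
    by (simp add: E_def B_def)
  then have E: "E \<in> o[F](\<lambda>m. 1 / ((B + c) * real m))"
    unfolding scale by (rule landau_o.small.filter_mono[OF F])
  have "(\<lambda>m. prob_first (a m) b m 1 + ?D m) \<sim>[F] (\<lambda>m. 1 / ((B + c) * real m))"
    using P1 by (simp only: asymp_equiv_add_right[OF D])
  moreover have "(\<lambda>m. E m + 1 / ((B + c) * real m)) \<sim>[F] (\<lambda>m. 1 / ((B + c) * real m))"
    by (simp only: asymp_equiv_add_left[OF E] asymp_equiv_refl)
  ultimately have "(\<lambda>m. prob_first (a m) b m 1 + ?D m) \<sim>[F] (\<lambda>m. E m + 1 / ((B + c) * real m))"
    using asymp_equiv_symI asymp_equiv_trans by blast
  then show "(\<lambda>m. prob_first (a m) b m (a m + j)) \<sim>[F]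
       (\<lambda>m. exp (c * real m / (real b * exp 1) - real b / (real b + c))
              * (real b / (real b + c)) ^ (m - 1) * (1 / (c * real m ^ 2))
              * (measure_pmf.prob (poisson_pmf (c * real m / (real b * exp 1)))
                   {y. \<lceil>real j / real b\<rceil> \<le> int y} - 1)
            + 1 / ((real b + c) * real m))"
    by (simp add: E_def B_def)
qed

end
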